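(* Let $f:\mathbb{N}\times\mathbb{R}^n\to\mathbb{R}^n$ be such that $f(k,\cdot)$ is $C^1$ for every $k\in\mathbb{N}$, with Jacobian $J(k,x):=\frac{\partial}{\partial x}f(k,x)$, and consider the system $$x(k+1)=f(k,x(k)),\qquad k\in\mathbb{N}.$$ Suppose that its trajectories evolve on a compact and convex set $\Omega\subset\mathbb{R}^n$. Suppose that there is an integer $T\ge 1$ such that $f(k,a)=f(k+T,a)$ for all $k\in\mathbb{N}$ and all $a\in\Omega$. For $k\in\mathbb{N}$ and $a,b\in\Omega$ let $$F(k,a,b):=\int_0^1 J(k,ra+(1-r)b)\,\mathrm{d}r .$$ Let $h\ge 1$ be an integer and suppose that the system $z(k+1)=F(k,\cdot,\cdot)z(k)$ is an oscillatory discrete-time system (ODTS) of order $h$, that is: $F(k,a,b)$ is oscillatory for all $k\in\mathbb{N}$ and all $a,b\in\Omega$, and every product of $h$ matrices $$F(k_h,a_h,b_h)\cdots F(k_2,a_2,b_2)F(k_1,a_1,b_1),\qquad 0\le k_1<k_2<\dots<k_h,\quad a_i,b_i\in\Omega,$$ is totally positive. Let $u:=hT$. Then every solution of $x(k+1)=f(k,x(k))$ emanating from $\Omega$ converges to a $u$-periodic solution of this system.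
   Context: $\mathbb{N}=\{0,1,2,\dots\}$. A matrix is totally positive (TP) if all its minors (of all orders) are positive, and totally nonnegative (TN) if all its minors are nonnegative. A square matrix $A$ is oscillatory if it is TN and there is an integer $m\ge1$ such that $A^m$ is TP. "The trajectories evolve on $\Omega$" means that $f(k,a)\in\Omega$ for all $k\in\mathbb{N}$ and $a\in\Omega$. A solution emanating from $\Omega$ is a solution with $x(0)\in\Omega$. A solution $\xi$ is $u$-periodic if $\xi(k+u)=\xi(k)$ for all $k\in\mathbb{N}$ (the minimal period may be smaller). "$x$ converges to a $u$-periodic solution" means that there is a $u$-periodic solution $\xi$ of the system with $x(k)-\xi(k)\to0$ as $k\to\infty$. *)

theory Defs
  imports
    "HOL-Analysis.Analysis"
    "Jordan_Normal_Form.Determinant"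
begin

no_notation Matrix.vec_index (infixl "$" 100)
no_notation Matrix.scalar_prod (infix "\<bullet>" 70)

text \<open>
  Minors depend on the order of the indices, so the index types carry a linear order:
  a type in \<open>{finite, linorder}\<close> with \<open>n\<close> elements plays the role of \<open>{1, ..., n}\<close>.
  A minor of order \<open>p\<close> is given by increasing sequences of \<open>p\<close> row and \<open>p\<close> column indices.
  Its size varies with \<open>p\<close>, so it uses the determinant of carrier-based matrices.
\<close>

definition minor ::
    "real ^ 'n::{finite,linorder} ^ 'm::{finite,linorder} \<Rightarrow> nat \<Rightarrow> (nat \<Rightarrow> 'm) \<Rightarrow> (nat \<Rightarrow> 'n) \<Rightarrow> real"
  where "minor A p \<rho> \<sigma> = Determinant.det (Matrix.mat p p (\<lambda>(i, j). A $ \<rho> i $ \<sigma> j))"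

definition totally_positive :: "real ^ 'n::{finite,linorder} ^ 'm::{finite,linorder} \<Rightarrow> bool"
  where "totally_positive A \<longleftrightarrow>
    (\<forall>p\<ge>1. \<forall>\<rho> \<sigma>. strict_mono_on {..<p} \<rho> \<longrightarrow> strict_mono_on {..<p} \<sigma> \<longrightarrow> minor A p \<rho> \<sigma> > 0)"

definition totally_nonneg :: "real ^ 'n::{finite,linorder} ^ 'm::{finite,linorder} \<Rightarrow> bool"
  where "totally_nonneg A \<longleftrightarrow>
    (\<forall>p\<ge>1. \<forall>\<rho> \<sigma>. strict_mono_on {..<p} \<rho> \<longrightarrow> strict_mono_on {..<p} \<sigma> \<longrightarrow> minor A p \<rho> \<sigma> \<ge> 0)"

text \<open>\<open>left_prod M h\<close> is \<open>M h ** ... ** M 2 ** M 1\<close>; \<open>M 0\<close> is not used.\<close>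

primrec left_prod :: "(nat \<Rightarrow> real ^ 'n ^ 'n) \<Rightarrow> nat \<Rightarrow> real ^ 'n ^ 'n"
  where
    "left_prod M 0 = Finite_Cartesian_Product.mat 1"
  | "left_prod M (Suc h) = M (Suc h) ** left_prod M h"

definition matrix_power :: "real ^ 'n ^ 'n \<Rightarrow> nat \<Rightarrow> real ^ 'n ^ 'n"
  where "matrix_power A m = left_prod (\<lambda>_. A) m"

definition oscillatory :: "real ^ 'n::{finite,linorder} ^ 'n::_ \<Rightarrow> bool"
  where "oscillatory A \<longleftrightarrow>
    totally_nonneg A \<and> (\<exists>m\<ge>1. totally_positive (matrix_power A m))"

definition C1_map :: "(real ^ 'n \<Rightarrow> real ^ 'm) \<Rightarrow> bool"
  where "C1_map g \<longleftrightarrow>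
    (\<forall>x. g differentiable (at x)) \<and> continuous_on UNIV (\<lambda>x. jacobian g (at x))"

definition segment_jacobian ::
    "(nat \<Rightarrow> real ^ 'n \<Rightarrow> real ^ 'n) \<Rightarrow> nat \<Rightarrow> real ^ 'n \<Rightarrow> real ^ 'n \<Rightarrow> real ^ 'n ^ 'n"
  where "segment_jacobian f k a b =
    integral {0..1} (\<lambda>r. jacobian (f k) (at (r *\<^sub>R a + (1 - r) *\<^sub>R b)))"

definition odts ::
    "nat \<Rightarrow> 'a set \<Rightarrow> (nat \<Rightarrow> 'a \<Rightarrow> 'a \<Rightarrow> real ^ 'n::{finite,linorder} ^ 'n::_) \<Rightarrow> bool"
  where "odts h \<Omega> F \<longleftrightarrow>
    (\<forall>k. \<forall>a\<in>\<Omega>. \<forall>b\<in>\<Omega>. oscillatory (F k a b)) \<and>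
    (\<forall>\<kappa> \<alpha> \<beta>. strict_mono_on {1..h} \<kappa> \<longrightarrow> \<alpha> ` {1..h} \<subseteq> \<Omega> \<longrightarrow> \<beta> ` {1..h} \<subseteq> \<Omega> \<longrightarrow>
      totally_positive (left_prod (\<lambda>i. F (\<kappa> i) (\<alpha> i) (\<beta> i)) h))"

definition trajectories_evolve_on :: "(nat \<Rightarrow> 'a \<Rightarrow> 'a) \<Rightarrow> 'a set \<Rightarrow> bool"
  where "trajectories_evolve_on f \<Omega> \<longleftrightarrow> (\<forall>k. \<forall>a\<in>\<Omega>. f k a \<in> \<Omega>)"

definition is_solution :: "(nat \<Rightarrow> 'a \<Rightarrow> 'a) \<Rightarrow> (nat \<Rightarrow> 'a) \<Rightarrow> bool"
  where "is_solution f x \<longleftrightarrow> (\<forall>k. x (k + 1) = f k (x k))"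

definition periodic_seq :: "nat \<Rightarrow> (nat \<Rightarrow> 'a) \<Rightarrow> bool"
  where "periodic_seq u \<xi> \<longleftrightarrow> (\<forall>k. \<xi> (k + u) = \<xi> k)"

definition converges_to_periodic_solution ::
    "(nat \<Rightarrow> 'a \<Rightarrow> 'a::real_normed_vector) \<Rightarrow> nat \<Rightarrow> (nat \<Rightarrow> 'a) \<Rightarrow> bool"
  where "converges_to_periodic_solution f u x \<longleftrightarrow>
    (\<exists>\<xi>. is_solution f \<xi> \<and> periodic_seq u \<xi> \<and> (\<lambda>k. x k - \<xi> k) \<longlonglongrightarrow> 0)"

end

theory Submission
  imports Defs
begin

text \<open>
  The difference \<open>z\<close> of two solutions in \<open>\<Omega>\<close> is multiplied over \<open>h\<close> steps by a totally positive
  matrix, so its number of sign changes never increases. Once this number is constant, the first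
  component of \<open>z\<close> is nonzero and keeps its sign. Applied to \<open>x (k + u) - x k\<close>, this makes the first
  component of \<open>x (m * u)\<close> eventually monotone, hence convergent. All limit points of \<open>x (m * u)\<close> therefore
  have orbits under the period map with one and the same constant first component; applied to
  the solutions starting at two such points, the sign property shows that the points coincide.
\<close>

section \<open>Variation diminution by totally positive matrices\<close>

lemma obtain_increasing_enumeration:
  fixes C :: "'a::linorder set"
  assumes "finite C"
  obtains \<sigma> where "strict_mono_on {..<card C} \<sigma>" "\<sigma> ` {..<card C} = C"
proof
  let ?xs = "sorted_list_of_set C"
  show "strict_mono_on {..<card C} (\<lambda>i. ?xs ! i)"
    using strict_sorted_list_of_set[of C]
    by (auto simp: strict_mono_on_def sorted_wrt_iff_nth_less)
  have "(\<lambda>i. ?xs ! i) ` {..<length ?xs} = set ?xs"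
    by (auto simp: set_conv_nth)
  then show "(\<lambda>i. ?xs ! i) ` {..<card C} = C"
    using assms by simp
qed

lemma strict_mono_on_insert_index:
  fixes \<sigma> :: "nat \<Rightarrow> 'a::linorder"
  assumes "strict_mono_on {..<p} \<sigma>"
  shows "strict_mono_on {..<p - 1} (\<sigma> \<circ> insert_index i)"
proof (rule strict_mono_onI)
  fix r s assume "r \<in> {..<p - 1}" "s \<in> {..<p - 1}" "r < s"
  then have "insert_index i r \<in> {..<p}" "insert_index i s \<in> {..<p}" "insert_index i r < insert_index i s"
    by (auto simp: insert_index_def)
  then show "(\<sigma> \<circ> insert_index i) r < (\<sigma> \<circ> insert_index i) s"
    unfolding comp_apply by (rule strict_mono_onD[OF assms])
qed

text \<open>Also admits order 0, where the determinant is 1. This case arises as soon as a row and a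
  column are deleted from a minor of order 1.\<close>

lemma minor_pos:
  assumes "totally_positive A" "strict_mono_on {..<p} \<rho>" "strict_mono_on {..<p} \<sigma>"
  shows "minor A p \<rho> \<sigma> > 0"
  using assms by (cases "p = 0") (auto simp: totally_positive_def minor_def)

text \<open>Composing with \<open>insert_index i\<close> deletes the entry at position
  \<open>i\<close>. Expressing the cofactor through a \<open>minor\<close> of \<open>A\<close>
  itself lets total positivity determine its sign.\<close>

definition minor_cofactor ::
    "real ^ 'n::{finite,linorder} ^ 'm::{finite,linorder} \<Rightarrow> nat \<Rightarrow> (nat \<Rightarrow> 'm) \<Rightarrow> (nat \<Rightarrow> 'n) \<Rightarrow> nat \<Rightarrow> nat \<Rightarrow> real"
  where "minor_cofactor A p \<rho> \<sigma> i j =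
    (-1) ^ (i + j) * minor A (p - 1) (\<rho> \<circ> insert_index i) (\<sigma> \<circ> insert_index j)"

lemma cofactor_mat_eq_minor_cofactor:
  assumes "i < p" "j < p"
  shows "cofactor (Matrix.mat p p (\<lambda>(i, j). A $ \<rho> i $ \<sigma> j)) i j = minor_cofactor A p \<rho> \<sigma> i j"
proof -
  have "mat_delete (Matrix.mat p p (\<lambda>(i, j). A $ \<rho> i $ \<sigma> j)) i j =
      Matrix.mat (p - 1) (p - 1) (\<lambda>(i', j'). A $ (\<rho> \<circ> insert_index i) i' $ (\<sigma> \<circ> insert_index j) j')"
    by (rule eq_matI) (auto simp: mat_delete_def insert_index_def)
  then show ?thesis
    by (simp add: cofactor_def minor_cofactor_def minor_def)
qed

text \<open>These are the entries of adj(B) B = det(B) I and B adj(B) = det(B) I, where B is the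
  submatrix of \<open>A\<close> on the rows \<rho> and the columns \<sigma>.\<close>

lemma
  assumes "i < p" "k < p"
  shows minor_cofactor_col:
      "(\<Sum>j<p. minor_cofactor A p \<rho> \<sigma> j i * A $ \<rho> j $ \<sigma> k) = (if i = k then minor A p \<rho> \<sigma> else 0)"
    and minor_cofactor_row:
      "(\<Sum>j<p. A $ \<rho> i $ \<sigma> j * minor_cofactor A p \<rho> \<sigma> k j) = (if i = k then minor A p \<rho> \<sigma> else 0)"
proof -
  define B where "B = Matrix.mat p p (\<lambda>(i, j). A $ \<rho> i $ \<sigma> j)"
  have B: "B \<in> carrier_mat p p" and det: "Determinant.det B = minor A p \<rho> \<sigma>"
    by (auto simp: B_def minor_def)
  have cof: "cofactor B i j = minor_cofactor A p \<rho> \<sigma> i j" if "i < p" "j < p" for i j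
    using cofactor_mat_eq_minor_cofactor[OF that] by (simp add: B_def)
  note adj = adj_mat[OF B]
  have "(\<Sum>j<p. minor_cofactor A p \<rho> \<sigma> j i * A $ \<rho> j $ \<sigma> k) = (adj_mat B * B) $$ (i, k)"
    using assms adj(1) B
    by (auto simp: scalar_prod_def adj_mat_def cof B_def[symmetric] atLeast0LessThan intro!: sum.cong)
       (auto simp: B_def)
  also have "\<dots> = (if i = k then minor A p \<rho> \<sigma> else 0)"
    unfolding adj(3) det using assms by simp
  finally show "(\<Sum>j<p. minor_cofactor A p \<rho> \<sigma> j i * A $ \<rho> j $ \<sigma> k) = (if i = k then minor A p \<rho> \<sigma> else 0)" .
  have "(\<Sum>j<p. A $ \<rho> i $ \<sigma> j * minor_cofactor A p \<rho> \<sigma> k j) = (B * adj_mat B) $$ (i, k)"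
    using assms adj(1) B
    by (auto simp: scalar_prod_def adj_mat_def cof B_def[symmetric] atLeast0LessThan intro!: sum.cong)
       (auto simp: B_def)
  also have "\<dots> = (if i = k then minor A p \<rho> \<sigma> else 0)"
    unfolding adj(2) det using assms by simp
  finally show "(\<Sum>j<p. A $ \<rho> i $ \<sigma> j * minor_cofactor A p \<rho> \<sigma> k j) = (if i = k then minor A p \<rho> \<sigma> else 0)" .
qed

lemma matrix_vector_mult_support:
  fixes A :: "real ^ 'n ^ 'm"
  assumes "inj_on \<sigma> {..<p}" "{c. x $ c \<noteq> 0} \<subseteq> \<sigma> ` {..<p}"
  shows "(A *v x) $ r = (\<Sum>j<p. A $ r $ \<sigma> j * x $ \<sigma> j)"
proof -
  have "(A *v x) $ r = (\<Sum>c\<in>\<sigma> ` {..<p}. A $ r $ c * x $ c)"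
    unfolding matrix_vector_mult_def using assms(2)
    by (auto intro!: sum.mono_neutral_right)
  also have "\<dots> = (\<Sum>j<p. A $ r $ \<sigma> j * x $ \<sigma> j)"
    using assms(1) by (simp add: sum.reindex)
  finally show ?thesis .
qed

text \<open>Cramer's rule without division: weight the equations of the rows \<rho> with the
  cofactors of column \<open>k\<close> and sum; all other columns cancel.\<close>

lemma cramer_minor:
  assumes "inj_on \<sigma> {..<p}" "{c. x $ c \<noteq> 0} \<subseteq> \<sigma> ` {..<p}" "k < p"
  shows "minor A p \<rho> \<sigma> * x $ \<sigma> k = (\<Sum>i<p. minor_cofactor A p \<rho> \<sigma> i k * (A *v x) $ \<rho> i)"
proof -
  have "(\<Sum>i<p. minor_cofactor A p \<rho> \<sigma> i k * (A *v x) $ \<rho> i) =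
      (\<Sum>i<p. \<Sum>j<p. minor_cofactor A p \<rho> \<sigma> i k * A $ \<rho> i $ \<sigma> j * x $ \<sigma> j)"
    by (simp add: matrix_vector_mult_support[OF assms(1,2)] sum_distrib_left mult.assoc)
  also have "\<dots> = (\<Sum>j<p. (\<Sum>i<p. minor_cofactor A p \<rho> \<sigma> i k * A $ \<rho> i $ \<sigma> j) * x $ \<sigma> j)"
    by (subst sum.swap) (simp add: sum_distrib_right)
  also have "\<dots> = (\<Sum>j<p. if k = j then minor A p \<rho> \<sigma> * x $ \<sigma> j else 0)"
    using assms(3) by (intro sum.cong) (auto simp: minor_cofactor_col)
  finally show ?thesis
    using assms(3) by (simp add: sum.delta)
qed

text \<open>The witness is adj(B) s, placed at the columns \<sigma> and extended by zero. The factor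
  \<open>minor A p \<rho> \<sigma>\<close> stays on the right-hand side, so nothing is
  divided.\<close>

lemma solve_minor:
  fixes A :: "real ^ 'n::{finite,linorder} ^ 'm::{finite,linorder}"
  assumes "inj_on \<sigma> {..<p}"
  obtains v where "{c. v $ c \<noteq> 0} \<subseteq> \<sigma> ` {..<p}"
    and "\<And>i. i < p \<Longrightarrow> (A *v v) $ \<rho> i = minor A p \<rho> \<sigma> * s i"
proof -
  define v where "v = (\<chi> c::'n. if c \<in> \<sigma> ` {..<p} then
    \<Sum>k<p. minor_cofactor A p \<rho> \<sigma> k (the_inv_into {..<p} \<sigma> c) * s k else 0)"
  have sup: "{c. v $ c \<noteq> 0} \<subseteq> \<sigma> ` {..<p}"
    by (auto simp: v_def)
  have v: "v $ \<sigma> j = (\<Sum>k<p. minor_cofactor A p \<rho> \<sigma> k j * s k)" if "j < p" for j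
    using that assms by (simp add: v_def the_inv_into_f_f)
  have "(A *v v) $ \<rho> i = minor A p \<rho> \<sigma> * s i" if "i < p" for i
  proof -
    have "(A *v v) $ \<rho> i = (\<Sum>j<p. \<Sum>k<p. A $ \<rho> i $ \<sigma> j * minor_cofactor A p \<rho> \<sigma> k j * s k)"
      by (simp add: matrix_vector_mult_support[OF assms sup] v sum_distrib_left mult.assoc)
    also have "\<dots> = (\<Sum>k<p. (\<Sum>j<p. A $ \<rho> i $ \<sigma> j * minor_cofactor A p \<rho> \<sigma> k j) * s k)"
      by (subst sum.swap) (simp add: sum_distrib_right)
    also have "\<dots> = (\<Sum>k<p. if i = k then minor A p \<rho> \<sigma> * s k else 0)"
      using that by (intro sum.cong) (auto simp: minor_cofactor_row)
    finally show ?thesis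
      using that by (simp add: sum.delta)
  qed
  with sup show thesis
    by (rule that)
qed

section \<open>Alternating sign patterns and variation diminution\<close>

text \<open>For e = 1 or e = -1 this says that \<open>p\<close> entries, read from left to right,
  strictly alternate in sign, the first having the sign \<open>e\<close>. So \<open>p\<close> counts
  entries, one more than the sign changes among them when p > 0.\<close>

definition alternates :: "nat \<Rightarrow> real \<Rightarrow> real ^ 'n::{finite,linorder} \<Rightarrow> bool"
  where "alternates p e x \<longleftrightarrow>
    (\<exists>\<sigma>. strict_mono_on {..<p} \<sigma> \<and> (\<forall>j<p. e * (-1) ^ j * x $ \<sigma> j > 0))"

lemma alternates_conformal:
  assumes "alternates p e x'" "\<And>c. x' $ c \<noteq> 0 \<Longrightarrow> x' $ c * x $ c > 0"
  shows "alternates p e x"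
proof -
  obtain \<sigma> where \<sigma>: "strict_mono_on {..<p} \<sigma>" "\<And>j. j < p \<Longrightarrow> e * (-1) ^ j * x' $ \<sigma> j > 0"
    using assms(1) by (auto simp: alternates_def)
  have "e * (-1) ^ j * x $ \<sigma> j > 0" if "j < p" for j
    using \<sigma>(2)[OF that] assms(2)[of "\<sigma> j"] by (auto simp: zero_less_mult_iff)
  with \<sigma>(1) show ?thesis
    by (auto simp: alternates_def)
qed

text \<open>In Cramer's rule the cofactor signs (-1)^(i + j) meet the alternating signs of the
  image. All summands for \<open>e * (-1) ^ j * x $ \<sigma> j\<close> become nonnegative, and row
  \<open>i\<close> contributes a positive one.\<close>

lemma alternates_small_support:
  fixes A :: "real ^ 'n::{finite,linorder} ^ 'm::{finite,linorder}"
  assumes tp: "totally_positive A"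
    and \<rho>: "strict_mono_on {..<p} \<rho>" and \<sigma>: "strict_mono_on {..<p} \<sigma>"
    and sup: "{c. x $ c \<noteq> 0} \<subseteq> \<sigma> ` {..<p}"
    and alt: "\<And>i. i < p \<Longrightarrow> 0 \<le> e * (-1) ^ i * (A *v x) $ \<rho> i"
    and nz: "i < p" "e * (A *v x) $ \<rho> i \<noteq> 0"
  shows "alternates p e x"
  unfolding alternates_def
proof (intro exI conjI allI impI)
  fix j assume j: "j < p"
  define c where "c i = minor A (p - 1) (\<rho> \<circ> insert_index i) (\<sigma> \<circ> insert_index j)" for i
  have c: "c i > 0" for i
    unfolding c_def using tp \<rho> \<sigma> by (intro minor_pos strict_mono_on_insert_index)
  have "minor A p \<rho> \<sigma> * (e * (-1) ^ j * x $ \<sigma> j) =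
      e * (-1) ^ j * (\<Sum>i<p. (-1) ^ (i + j) * c i * (A *v x) $ \<rho> i)"
    using cramer_minor[OF strict_mono_on_imp_inj_on[OF \<sigma>] sup j, of A \<rho>]
    by (simp add: minor_cofactor_def c_def)
  also have "\<dots> = (\<Sum>i<p. c i * (e * (-1) ^ i * (A *v x) $ \<rho> i))"
    by (auto simp: sum_distrib_left power_add mult_ac intro!: sum.cong)
  also have "\<dots> > 0"
  proof (rule sum_pos2)
    have "0 \<noteq> e * (-1) ^ i * (A *v x) $ \<rho> i"
      using nz(2) by simp
    with alt[OF nz(1)] have "0 < e * (-1) ^ i * (A *v x) $ \<rho> i"
      by (rule le_neq_trans)
    with c show "0 < c i * (e * (-1) ^ i * (A *v x) $ \<rho> i)"
      by (rule mult_pos_pos)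
    show "0 \<le> c j * (e * (-1) ^ j * (A *v x) $ \<rho> j)" if "j \<in> {..<p}" for j
      using that c[of j] by (intro mult_nonneg_nonneg alt) auto
  qed (use nz(1) in auto)
  finally show "e * (-1) ^ j * x $ \<sigma> j > 0"
    using minor_pos[OF tp \<rho> \<sigma>] by (rule zero_less_mult_pos)
qed (rule \<sigma>)

text \<open>Rows and columns share one index type, so the \<open>p\<close> distinct rows \<rho> show
  that \<open>p\<close> distinct columns exist, and \<open>S\<close> can be padded to exactly
  \<open>p\<close> of them.\<close>

lemma obtain_columns:
  fixes S :: "'n::{finite,linorder} set" and \<rho> :: "nat \<Rightarrow> 'n"
  assumes "strict_mono_on {..<p} \<rho>" "card S \<le> p"
  obtains \<sigma> :: "nat \<Rightarrow> 'n" where "strict_mono_on {..<p} \<sigma>" "S \<subseteq> \<sigma> ` {..<p}"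
proof -
  have "p \<le> card (UNIV :: 'n set)"
    using card_mono[of UNIV "\<rho> ` {..<p}"] strict_mono_on_imp_inj_on[OF assms(1)]
    by (simp add: card_image)
  then obtain C where C: "S \<subseteq> C" "card C = p"
    using exists_subset_between[of S p UNIV] assms(2) by auto
  obtain \<sigma> where "strict_mono_on {..<card C} \<sigma>" "\<sigma> ` {..<card C} = C"
    using obtain_increasing_enumeration[OF finite] by blast
  with C show thesis
    by (intro that[of \<sigma>]) simp_all
qed

lemma obtain_subcolumns:
  fixes S :: "'n::{finite,linorder} set"
  assumes "p \<le> card S"
  obtains \<sigma> :: "nat \<Rightarrow> 'n" where "strict_mono_on {..<p} \<sigma>" "\<sigma> ` {..<p} \<subseteq> S"
proof -
  obtain C where C: "C \<subseteq> S" "card C = p"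
    using obtain_subset_with_card_n[OF assms] by auto
  obtain \<sigma> where "strict_mono_on {..<card C} \<sigma>" "\<sigma> ` {..<card C} = C"
    using obtain_increasing_enumeration[OF finite] by blast
  with C show thesis
    by (intro that[of \<sigma>]) simp_all
qed

text \<open>
  As long as more than \<open>p\<close> coordinates are nonzero, subtracting a multiple of a kernel vector of the
  chosen \<open>p\<close> rows annihilates a coordinate without flipping any sign.
\<close>

lemma variation_diminishing_nonzero:
  fixes A :: "real ^ 'n::{finite,linorder} ^ 'n::_"
  assumes tp: "totally_positive A" and \<rho>: "strict_mono_on {..<p} \<rho>"
    and alt: "\<And>i. i < p \<Longrightarrow> 0 \<le> e * (-1) ^ i * (A *v x) $ \<rho> i"
    and nz: "i < p" "e * (A *v x) $ \<rho> i \<noteq> 0"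
  shows "alternates p e x"
  using alt nz(2)
proof (induction "card {c. x $ c \<noteq> 0}" arbitrary: x rule: less_induct)
  case less
  let ?S = "{c. x $ c \<noteq> 0}"
  show ?case
  proof (cases "card ?S \<le> p")
    case True
    then obtain \<sigma> where "strict_mono_on {..<p} \<sigma>" "?S \<subseteq> \<sigma> ` {..<p}"
      using obtain_columns[OF \<rho>] by metis
    then show ?thesis
      by (rule alternates_small_support[OF tp \<rho> _ _ less.prems(1) nz(1) less.prems(2)])
  next
    case False
    then obtain \<sigma> where \<sigma>: "strict_mono_on {..<p} \<sigma>" "\<sigma> ` {..<p} \<subseteq> ?S"
      using obtain_subcolumns[of p ?S] by auto
    note inj = strict_mono_on_imp_inj_on[OF \<sigma>(1)]
    have "card (\<sigma> ` {..<p}) < card ?S"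
      using False inj by (simp add: card_image)
    then have "\<not> ?S \<subseteq> \<sigma> ` {..<p}"
      using card_mono[of "\<sigma> ` {..<p}" ?S] by auto
    then obtain d where d: "x $ d \<noteq> 0" "d \<notin> \<sigma> ` {..<p}"
      by blast
    obtain v where v: "{c. v $ c \<noteq> 0} \<subseteq> \<sigma> ` {..<p}"
      and Av: "\<And>i. i < p \<Longrightarrow> (A *v v) $ \<rho> i = minor A p \<rho> \<sigma> * A $ \<rho> i $ d"
      using solve_minor[OF inj, of A \<rho> "\<lambda>i. A $ \<rho> i $ d"] by blast
    \<comment> \<open>On the rows \<rho>, \<open>A *v v\<close> is column \<open>d\<close> times the
      minor. Subtracting the same multiple of the unit vector at \<open>d\<close> gives a vector
      that \<open>A\<close> kills there, and \<open>w $ d\<close> is the negated minor, hence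
      nonzero.\<close>
    define w where "w = v - axis d (minor A p \<rho> \<sigma>)"
    have Aw: "(A *v w) $ \<rho> i = 0" if "i < p" for i
    proof -
      have "(A *v axis d (minor A p \<rho> \<sigma>)) $ \<rho> i = A $ \<rho> i $ d * minor A p \<rho> \<sigma>"
        by (simp add: matrix_vector_mult_def axis_def mult_delta_right)
      then show ?thesis
        using that by (simp add: w_def matrix_vector_mult_diff_distrib Av)
    qed
    have wS: "w $ c = 0" if "x $ c = 0" for c
    proof -
      have "c \<notin> \<sigma> ` {..<p}" "c \<noteq> d"
        using that \<sigma>(2) d by auto
      then show ?thesis
        using v by (auto simp: w_def axis_def)
    qed
    have "v $ d = 0"
      using v d(2) by blast
    then have wd: "w $ d \<noteq> 0"
      using minor_pos[OF tp \<rho> \<sigma>(1)] by (simp add: w_def axis_def)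
    \<comment> \<open>Ratio test: let \<open>m\<close> maximise this ratio. With
      \<open>t = x $ m / w $ m\<close> the vector \<open>x - t *\<^sub>R w\<close> vanishes at
      \<open>m\<close>, and \<open>t * w $ c\<close> never exceeds \<open>x $ c\<close> in absolute
      value, so no entry passes through zero.\<close>
    define g where "g c = \<bar>w $ c\<bar> / \<bar>x $ c\<bar>" for c
    have "Max (g ` ?S) \<in> g ` ?S"
      using d by (intro Max_in) auto
    then obtain m where m: "m \<in> ?S" "Max (g ` ?S) = g m"
      by auto
    have g_max: "g c \<le> g m" if "x $ c \<noteq> 0" for c
      using that unfolding m(2)[symmetric] by (intro Max_ge) auto
    have "g d > 0"
      using d wd by (simp add: g_def)
    then have wm: "w $ m \<noteq> 0"
      using g_max[OF d(1)] by (auto simp: g_def)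
    define t where "t = x $ m / w $ m"
    define x' where "x' = x - t *\<^sub>R w"
    have bound: "\<bar>t * w $ c\<bar> \<le> \<bar>x $ c\<bar>" for c
    proof (cases "x $ c = 0")
      case False
      have "\<bar>w $ c\<bar> = g c * \<bar>x $ c\<bar>"
        using False by (simp add: g_def)
      also have "\<dots> \<le> g m * \<bar>x $ c\<bar>"
        using g_max[OF False] by (rule mult_right_mono) simp
      finally have "\<bar>t\<bar> * \<bar>w $ c\<bar> \<le> \<bar>t\<bar> * (g m * \<bar>x $ c\<bar>)"
        by (rule mult_left_mono) simp
      moreover have "\<bar>t\<bar> * g m = 1"
        using wm m(1) by (simp add: t_def g_def)
      ultimately show ?thesis
        by (simp add: abs_mult flip: mult.assoc)
    qed (simp add: wS)
    have conf: "x' $ c * x $ c > 0" if "x' $ c \<noteq> 0" for c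
    proof (cases "x $ c" "0 :: real" rule: linorder_cases)
      case less
      then have "x' $ c \<le> 0"
        using bound[of c] by (simp add: x'_def)
      then show ?thesis
        using that less by (simp add: mult_neg_neg)
    next
      case greater
      then have "x' $ c \<ge> 0"
        using bound[of c] by (simp add: x'_def)
      then show ?thesis
        using that greater by simp
    qed (use that wS in \<open>simp add: x'_def\<close>)
    have Ax': "(A *v x') $ \<rho> i = (A *v x) $ \<rho> i" if "i < p" for i
      using Aw[OF that]
      by (simp add: x'_def matrix_vector_mult_diff_distrib matrix_vector_mult_scaleR)
    have "x' $ m = 0"
      using wm by (simp add: x'_def t_def)
    then have "m \<notin> {c. x' $ c \<noteq> 0}"
      by simp
    moreover have "{c. x' $ c \<noteq> 0} \<subseteq> ?S"
    proof
      fix c assume "c \<in> {c. x' $ c \<noteq> 0}"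
      then show "c \<in> ?S"
        using conf[of c] by auto
    qed
    ultimately have "{c. x' $ c \<noteq> 0} \<subset> ?S"
      using m(1) by blast
    then have "card {c. x' $ c \<noteq> 0} < card ?S"
      by (intro psubset_card_mono) auto
    then have "alternates p e x'"
      by (rule less.hyps) (use less.prems Ax' nz(1) in simp_all)
    then show ?thesis
      using conf by (rule alternates_conformal)
  qed
qed

text \<open>Zero entries of the image may be counted with either sign, even if all chosen ones
  vanish. This later allows a row with a vanishing image entry to be put in front of an alternating
  pattern.\<close>

lemma variation_diminishing:
  fixes A :: "real ^ 'n::{finite,linorder} ^ 'n::_"
  assumes tp: "totally_positive A" and \<rho>: "strict_mono_on {..<p} \<rho>"
    and alt: "\<And>i. i < p \<Longrightarrow> 0 \<le> e * (-1) ^ i * (A *v x) $ \<rho> i"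
    and "x \<noteq> 0" "e \<noteq> 0"
  shows "alternates p e x"
proof (cases "p > 0 \<and> (\<forall>i<p. (A *v x) $ \<rho> i = 0)")
  case False
  then show ?thesis
    using variation_diminishing_nonzero[OF tp \<rho> alt] \<open>e \<noteq> 0\<close>
    by (cases "p = 0") (auto simp: alternates_def)
next
  case True
  \<comment> \<open>Here the image vanishes on the rows \<open>\<rho>\<close>: a small perturbation of \<open>x\<close> within its support makes
    the image alternate strictly there.\<close>
  let ?S = "{c. x $ c \<noteq> 0}"
  \<comment> \<open>If the support fitted into \<open>p\<close> columns, Cramer's rule with
    vanishing right-hand sides would give \<open>x = 0\<close>.\<close>
  have "card ?S > p"
  proof (rule ccontr)
    assume "\<not> card ?S > p"
    then obtain \<sigma> where \<sigma>: "strict_mono_on {..<p} \<sigma>" "?S \<subseteq> \<sigma> ` {..<p}"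
      using obtain_columns[OF \<rho>] by (metis not_le)
    obtain c where "x $ c \<noteq> 0"
      using \<open>x \<noteq> 0\<close> by (auto simp: Finite_Cartesian_Product.vec_eq_iff)
    then obtain k where "k < p" "x $ \<sigma> k \<noteq> 0"
      using \<sigma>(2) by blast
    then show False
      using cramer_minor[OF strict_mono_on_imp_inj_on[OF \<sigma>(1)] \<sigma>(2), of k A \<rho>] True
        minor_pos[OF tp \<rho> \<sigma>(1)] by simp
  qed
  then obtain \<sigma> where \<sigma>: "strict_mono_on {..<p} \<sigma>" "\<sigma> ` {..<p} \<subseteq> ?S"
    using obtain_subcolumns[of p ?S] by auto
  note pos = minor_pos[OF tp \<rho> \<sigma>(1)]
  obtain v where v: "{c. v $ c \<noteq> 0} \<subseteq> \<sigma> ` {..<p}"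
    and Av: "\<And>i. i < p \<Longrightarrow> (A *v v) $ \<rho> i = minor A p \<rho> \<sigma> * (e * (-1) ^ i)"
    using solve_minor[OF strict_mono_on_imp_inj_on[OF \<sigma>(1)], of A \<rho> "\<lambda>i. e * (-1) ^ i"] by blast
  \<comment> \<open>Small enough that no entry of \<open>x\<close> changes its sign. The summand 1
    in the denominator avoids division by zero and makes the bound below strict; inserting 1 keeps
    the set visibly nonempty.\<close>
  define \<delta> where "\<delta> = Min (insert 1 ((\<lambda>c. \<bar>x $ c\<bar> / (1 + \<bar>v $ c\<bar>)) ` ?S))"
  have "\<delta> > 0"
    by (auto simp: \<delta>_def divide_pos_pos add_pos_nonneg)
  have \<delta>: "\<bar>\<delta> * v $ c\<bar> < \<bar>x $ c\<bar>" if "x $ c \<noteq> 0" for c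
  proof -
    have "\<delta> \<le> \<bar>x $ c\<bar> / (1 + \<bar>v $ c\<bar>)"
      using that by (auto simp: \<delta>_def intro!: Min_le)
    then have "\<delta> + \<delta> * \<bar>v $ c\<bar> \<le> \<bar>x $ c\<bar>"
      by (simp add: field_simps add_pos_nonneg)
    then show ?thesis
      using \<open>\<delta> > 0\<close> by (simp add: abs_mult)
  qed
  define x' where "x' = x + \<delta> *\<^sub>R v"
  have conf: "x' $ c * x $ c > 0" if "x' $ c \<noteq> 0" for c
  proof -
    have "x $ c \<noteq> 0"
    proof
      assume "x $ c = 0"
      then have "c \<notin> \<sigma> ` {..<p}"
        using \<sigma>(2) by auto
      then have "v $ c = 0"
        using v by auto
      then show False
        using that \<open>x $ c = 0\<close> by (simp add: x'_def)
    qed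
    then show ?thesis
    proof (cases "x $ c" "0 :: real" rule: linorder_cases)
      case less
      then have "x' $ c < 0"
        using \<delta>[of c] by (simp add: x'_def)
      then show ?thesis
        using less by (simp add: mult_neg_neg)
    next
      case greater
      then have "x' $ c > 0"
        using \<delta>[of c] by (simp add: x'_def)
      then show ?thesis
        using greater by simp
    qed simp
  qed
  have Ax': "(A *v x') $ \<rho> i = \<delta> * minor A p \<rho> \<sigma> * (e * (-1) ^ i)" if "i < p" for i
    using True that
    by (simp add: x'_def matrix_vector_right_distrib matrix_vector_mult_scaleR Av)
  have "alternates p e x'"
  proof (rule variation_diminishing_nonzero[OF tp \<rho>])
    fix i assume "i < p"
    then have "e * (-1) ^ i * (A *v x') $ \<rho> i = \<delta> * minor A p \<rho> \<sigma> * (e * (-1) ^ i)\<^sup>2"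
      by (simp add: Ax' power2_eq_square)
    then show "0 \<le> e * (-1) ^ i * (A *v x') $ \<rho> i"
      using pos \<open>\<delta> > 0\<close> by simp
  next
    show "0 < p" "e * (A *v x') $ \<rho> 0 \<noteq> 0"
      using True pos \<open>\<delta> > 0\<close> \<open>e \<noteq> 0\<close> by (simp_all add: Ax')
  qed
  then show ?thesis
    using conf by (rule alternates_conformal)
qed

text \<open>The determinant of \<open>A\<close> is its minor of full order, so it is positive and
  Cramer's rule applies to all rows and columns.\<close>

lemma totally_positive_mult_eq_0:
  fixes A :: "real ^ 'n::{finite,linorder} ^ 'n::_"
  assumes tp: "totally_positive A" and "A *v x = 0"
  shows "x = 0"
proof -
  obtain \<sigma> :: "nat \<Rightarrow> 'n" where \<sigma>: "strict_mono_on {..<CARD('n)} \<sigma>" "\<sigma> ` {..<CARD('n)} = UNIV"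
    using obtain_increasing_enumeration[OF finite] by blast
  have "x $ \<sigma> k = 0" if "k < CARD('n)" for k
    using cramer_minor[OF strict_mono_on_imp_inj_on[OF \<sigma>(1)] _ that, of x A \<sigma>] \<sigma>(2)
      minor_pos[OF tp \<sigma>(1) \<sigma>(1)] \<open>A *v x = 0\<close> by auto
  moreover have "\<exists>k<CARD('n). c = \<sigma> k" for c
    using \<sigma>(2) by blast
  ultimately have "x $ c = 0" for c
    by metis
  then show ?thesis
    by (simp add: Finite_Cartesian_Product.vec_eq_iff)
qed

section \<open>The number of sign alternations along products\<close>

lemma alternates_le_card:
  fixes x :: "real ^ 'n::{finite,linorder}"
  assumes "alternates p e x"
  shows "p \<le> CARD('n)"
proof -
  obtain \<sigma> :: "nat \<Rightarrow> 'n" where "strict_mono_on {..<p} \<sigma>"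
    using assms by (auto simp: alternates_def)
  then have "card (\<sigma> ` {..<p}) = p"
    by (simp add: card_image strict_mono_on_imp_inj_on)
  then show ?thesis
    using card_mono[of UNIV "\<sigma> ` {..<p}"] by simp
qed

text \<open>\<open>Min UNIV\<close> plays the role of the first coordinate. The lemma serves to
  lengthen an alternating pattern at its front.\<close>

lemma strict_mono_on_prepend:
  fixes \<sigma> :: "nat \<Rightarrow> 'n::{finite,linorder}"
  assumes "strict_mono_on {..<p} \<sigma>" "p > 0 \<Longrightarrow> \<sigma> 0 \<noteq> Min UNIV"
  shows "strict_mono_on {..<Suc p} (case_nat (Min UNIV) \<sigma>)"
proof (rule strict_mono_onI)
  fix r s assume rs: "r \<in> {..<Suc p}" "s \<in> {..<Suc p}" "r < s"
  then obtain s' where s': "s = Suc s'" "s' < p"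
    by (cases s) auto
  have Min_less: "Min UNIV < \<sigma> 0"
    using s' assms(2) by (simp add: less_le)
  show "case_nat (Min UNIV) \<sigma> r < case_nat (Min UNIV) \<sigma> s"
  proof (cases r)
    case 0
    have "\<sigma> 0 \<le> \<sigma> s'"
      using strict_mono_onD[OF assms(1), of 0 s'] s' by (cases "s' = 0") auto
    then show ?thesis
      using 0 s' Min_less by simp
  next
    case (Suc r')
    then show ?thesis
      using strict_mono_onD[OF assms(1), of r' s'] s' rs by simp
  qed
qed

text \<open>For nonzero \<open>x\<close> this is one more than the number of sign changes of
  \<open>x\<close> after its zeros are dropped; for \<open>x = 0\<close> it is 0, as only
  \<open>p = 0\<close> qualifies.\<close>

definition variation :: "real ^ 'n::{finite,linorder} \<Rightarrow> nat"
  where "variation x = Max {p. alternates p 1 x \<or> alternates p (-1) x}"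

lemma finite_alternates:
  fixes x :: "real ^ 'n::{finite,linorder}"
  shows "finite {p. alternates p 1 x \<or> alternates p (-1) x}"
  by (rule finite_subset[of _ "{..CARD('n)}"]) (auto dest: alternates_le_card)

lemma variation_ge: "alternates p e x \<Longrightarrow> e = 1 \<or> e = -1 \<Longrightarrow> p \<le> variation x"
  unfolding variation_def by (intro Max_ge finite_alternates) auto

lemma obtain_variation:
  obtains e where "e = 1 \<or> e = -1" "alternates (variation x) e x"
proof -
  have "alternates 0 1 x"
    by (auto simp: alternates_def)
  then have "variation x \<in> {p. alternates p 1 x \<or> alternates p (-1) x}"
    unfolding variation_def by (intro Max_in finite_alternates) auto
  then show thesis
    using that by blast
qed

lemma alternates_mult:
  fixes A :: "real ^ 'n::{finite,linorder} ^ 'n::_"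
  assumes "totally_positive A" "x \<noteq> 0" "e \<noteq> 0" "alternates p e (A *v x)"
  shows "alternates p e x"
proof -
  obtain \<sigma> where "strict_mono_on {..<p} \<sigma>" "\<And>j. j < p \<Longrightarrow> 0 < e * (-1) ^ j * (A *v x) $ \<sigma> j"
    using assms(4) by (auto simp: alternates_def)
  then show ?thesis
    by (intro variation_diminishing[OF assms(1) _ _ assms(2,3)]) (auto simp: order.order_iff_strict)
qed

lemma variation_mult_le:
  fixes A :: "real ^ 'n::{finite,linorder} ^ 'n::_"
  assumes "totally_positive A" "x \<noteq> 0"
  shows "variation (A *v x) \<le> variation x"
proof -
  obtain e where e: "e = 1 \<or> e = -1" "alternates (variation (A *v x)) e (A *v x)"
    by (rule obtain_variation)
  then have "alternates (variation (A *v x)) e x"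
    by (intro alternates_mult[OF assms]) auto
  then show ?thesis
    using e(1) by (rule variation_ge)
qed

text \<open>Take a longest alternating pattern of the image, with first sign \<open>e\<close>. If
  the first component of the image did not have the sign \<open>e\<close>, or that of
  \<open>x\<close> had the opposite sign, a pattern of \<open>x\<close> could be lengthened at its
  front, exceeding its variation.\<close>

lemma first_component_if_variation_eq:
  fixes A :: "real ^ 'n::{finite,linorder} ^ 'n::_"
  assumes tp: "totally_positive A" and "x \<noteq> 0" and eq: "variation (A *v x) = variation x"
  shows "(A *v x) $ Min UNIV \<noteq> 0" and "0 \<le> (A *v x) $ Min UNIV * x $ Min UNIV"
proof -
  define y where "y = A *v x"
  define N where "N = variation x"
  have "variation y = N"
    using eq by (simp add: y_def N_def)
  then obtain e where e: "e = 1 \<or> e = -1" "alternates N e y"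
    using obtain_variation[of y] by metis
  obtain \<sigma> where \<sigma>: "strict_mono_on {..<N} \<sigma>" "\<And>j. j < N \<Longrightarrow> 0 < e * (-1) ^ j * y $ \<sigma> j"
    using e(2) by (auto simp: alternates_def)
  have y_pos: "0 < e * y $ Min UNIV"
  proof (rule ccontr)
    assume neg: "\<not> 0 < e * y $ Min UNIV"
    \<comment> \<open>Prepending moves every position by one, hence the sign \<open>-e\<close>. The
      new first entry of the image may be zero, which variation diminution permits.\<close>
    have "alternates (Suc N) (-e) x"
    proof (rule variation_diminishing[OF tp])
      show "strict_mono_on {..<Suc N} (case_nat (Min UNIV) \<sigma>)"
        using \<sigma>(2)[of 0] neg by (intro strict_mono_on_prepend \<sigma>(1)) auto
      show "0 \<le> - e * (-1) ^ i * (A *v x) $ (case_nat (Min UNIV) \<sigma> i)" if "i < Suc N" for i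
        using neg that \<sigma>(2)[of "i - 1"] by (cases i) (simp_all add: y_def)
    qed (use e(1) \<open>x \<noteq> 0\<close> in auto)
    then have "Suc N \<le> variation x"
      using e(1) by (intro variation_ge[of _ "-e"]) auto
    then show False
      by (simp add: N_def)
  qed
  have x_nonneg: "0 \<le> e * x $ Min UNIV"
  proof (rule ccontr)
    assume neg: "\<not> 0 \<le> e * x $ Min UNIV"
    have "alternates N e x"
      using e(1) by (intro alternates_mult[OF tp \<open>x \<noteq> 0\<close> _ e(2)[unfolded y_def]]) auto
    then obtain \<tau> where \<tau>: "strict_mono_on {..<N} \<tau>" "\<And>j. j < N \<Longrightarrow> 0 < e * (-1) ^ j * x $ \<tau> j"
      by (auto simp: alternates_def)
    have "alternates (Suc N) (-e) x"
      unfolding alternates_def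
    proof (intro exI conjI allI impI)
      show "strict_mono_on {..<Suc N} (case_nat (Min UNIV) \<tau>)"
        using \<tau>(2)[of 0] neg by (intro strict_mono_on_prepend \<tau>(1)) auto
      show "0 < - e * (-1) ^ i * x $ (case_nat (Min UNIV) \<tau> i)" if "i < Suc N" for i
        using neg that \<tau>(2)[of "i - 1"] by (cases i) auto
    qed
    then have "Suc N \<le> variation x"
      using e(1) by (intro variation_ge[of _ "-e"]) auto
    then show False
      by (simp add: N_def)
  qed
  show "(A *v x) $ Min UNIV \<noteq> 0" "0 \<le> (A *v x) $ Min UNIV * x $ Min UNIV"
    using e(1) y_pos x_nonneg
    by (auto simp: zero_le_mult_iff simp flip: y_def)
qed

text \<open>The variation is a nonincreasing sequence of naturals, hence constant from some
  \<open>K\<close> on; from there each step keeps the sign of the first component.\<close>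

lemma eventually_constant_sign:
  fixes A :: "nat \<Rightarrow> real ^ 'n::{finite,linorder} ^ 'n::_"
  assumes tp: "\<And>m. totally_positive (A m)" and z: "\<And>m. z (Suc m) = A m *v z m" and "z 0 \<noteq> 0"
  shows "\<exists>e K. (e = 1 \<or> e = (-1::real)) \<and> (\<forall>m\<ge>K. 0 < e * z m $ Min UNIV)"
proof -
  have nz: "z m \<noteq> 0" for m
    by (induction m) (use assms totally_positive_mult_eq_0[OF tp] in auto)
  have "variation (z (Suc m)) \<le> variation (z m)" for m
    unfolding z by (rule variation_mult_le[OF tp nz])
  then have dec: "variation (z m) \<le> variation (z n)" if "n \<le> m" for n m
    using that by (rule lift_Suc_antimono_le)
  obtain K where K: "\<And>m. variation (z K) \<le> variation (z m)"
    using ex_has_least_nat[of "\<lambda>_. True" 0 "\<lambda>m. variation (z m)"] by auto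
  have eq: "variation (A m *v z m) = variation (z m)" if "m \<ge> K" for m
    using K[of m] K[of "Suc m"] dec[of K m] dec[of K "Suc m"] that by (simp flip: z)
  note first = first_component_if_variation_eq[OF tp nz eq, folded z]
  \<comment> \<open>The sign is read off at \<open>Suc K\<close>, because at \<open>K\<close> itself
    the first component may still vanish.\<close>
  define e where "e = sgn (z (Suc K) $ Min UNIV)"
  show ?thesis
  proof (intro exI conjI allI impI)
    show "e = 1 \<or> e = -1"
      using first(1)[of K] by (auto simp: e_def sgn_if)
    show "0 < e * z m $ Min UNIV" if "m \<ge> Suc K" for m
      using that
    proof (induction m rule: dec_induct)
      case base
      then show ?case
        using first(1)[of K] by (simp add: e_def sgn_mult_self_eq sgn_if)
    next
      case (step m)
      have "0 \<le> z (Suc m) $ Min UNIV * z m $ Min UNIV" "z (Suc m) $ Min UNIV \<noteq> 0"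
        using first[of m] step.hyps by auto
      then show ?case
        using step.IH by (auto simp: zero_less_mult_iff zero_le_mult_iff)
    qed
  qed
qed

section \<open>Solutions and their limit points\<close>

text \<open>Fundamental theorem of calculus along the segment from \<open>b\<close> to
  \<open>a\<close>. It turns the difference of two solutions into a solution of the linear
  recursion.\<close>

lemma segment_jacobian_mult:
  fixes f :: "nat \<Rightarrow> real ^ 'n \<Rightarrow> real ^ 'n"
  assumes "C1_map (f k)"
  shows "segment_jacobian f k a b *v (a - b) = f k a - f k b"
proof -
  define p where "p r = r *\<^sub>R a + (1 - r) *\<^sub>R b" for r :: real
  define J where "J x = jacobian (f k) (at x)" for x
  have der: "(f k has_derivative (\<lambda>v. J x *v v)) (at x)" for x
    using assms jacobian_works unfolding C1_map_def J_def by blast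
  have contJ: "continuous_on UNIV J"
    using assms unfolding C1_map_def J_def by blast
  have "(p has_vector_derivative (a - b)) (at r within {0..1})" for r
    unfolding p_def by (auto intro!: derivative_eq_intros simp: algebra_simps)
  then have D: "((f k \<circ> p) has_vector_derivative (J (p r) *v (a - b))) (at r within {0..1})" for r
    using vector_derivative_diff_chain_within has_derivative_at_withinI[OF der] by blast
  have I1: "((\<lambda>r. J (p r) *v (a - b)) has_integral ((f k \<circ> p) 1 - (f k \<circ> p) 0)) {0..1}"
    by (intro fundamental_theorem_of_calculus zero_le_one D)
  have "continuous_on {0..1} (\<lambda>r. J (p r))"
    by (rule continuous_on_compose2[OF contJ]) (auto simp: p_def intro!: continuous_intros)
  then have "((\<lambda>r. J (p r)) has_integral integral {0..1} (\<lambda>r. J (p r))) {0..1}"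
    by (intro integrable_integral integrable_continuous_real)
  \<comment> \<open>Applying a matrix to the fixed vector \<open>a - b\<close> is linear in the
    matrix, so it may be exchanged with the integral.\<close>
  moreover have "bounded_linear (\<lambda>M :: real ^ 'n ^ 'n. M *v (a - b))"
    unfolding linear_conv_bounded_linear[symmetric]
    by (rule linearI) (simp_all add: matrix_vector_mult_add_rdistrib scaleR_matrix_vector_assoc)
  ultimately have "((\<lambda>M. M *v (a - b)) \<circ> (\<lambda>r. J (p r)) has_integral
      integral {0..1} (\<lambda>r. J (p r)) *v (a - b)) {0..1}"
    by (rule has_integral_linear)
  then have "integral {0..1} (\<lambda>r. J (p r)) *v (a - b) = (f k \<circ> p) 1 - (f k \<circ> p) 0"
    using I1 by (intro has_integral_unique) (simp_all add: comp_def)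
  then show ?thesis
    by (simp add: segment_jacobian_def J_def p_def)
qed

primrec flow :: "(nat \<Rightarrow> 'a \<Rightarrow> 'a) \<Rightarrow> 'a \<Rightarrow> nat \<Rightarrow> 'a"
  where
    "flow f a 0 = a"
  | "flow f a (Suc k) = f k (flow f a k)"

lemma is_solution_flow: "is_solution f (flow f a)"
  by (simp add: is_solution_def)

lemma is_solution_eq_flow: "is_solution f x \<Longrightarrow> x k = flow f (x 0) k"
  by (induction k) (simp_all add: is_solution_def)

lemma flow_in:
  assumes "trajectories_evolve_on f \<Omega>" "a \<in> \<Omega>"
  shows "flow f a k \<in> \<Omega>"
  by (induction k) (use assms in \<open>simp_all add: trajectories_evolve_on_def\<close>)

lemma continuous_on_flow:
  assumes "\<And>k. C1_map (f k)"
  shows "continuous_on UNIV (\<lambda>a. flow f a k)"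
proof (induction k)
  case (Suc k)
  have "continuous_on UNIV (f k)"
    using assms[of k] differentiable_imp_continuous_within
    by (auto simp: C1_map_def continuous_on_eq_continuous_at)
  then show ?case
    using continuous_on_compose2[OF _ Suc, of UNIV "f k"] by simp
qed (simp add: continuous_on_id)

text \<open>If \<open>w\<close> did not converge to its limit point \<open>p\<close>, infinitely
  many terms would keep a distance from \<open>p\<close>, and by compactness they would have a limit
  point other than \<open>p\<close>.\<close>

lemma tendsto_if_limit_point_unique:
  fixes w :: "nat \<Rightarrow> 'a::metric_space"
  assumes "compact S" "\<And>m. w m \<in> S"
    and uniq: "\<And>r s p q. strict_mono r \<Longrightarrow> strict_mono s \<Longrightarrow> p \<in> S \<Longrightarrow> q \<in> S \<Longrightarrow>
      (w \<circ> r) \<longlonglongrightarrow> p \<Longrightarrow> (w \<circ> s) \<longlonglongrightarrow> q \<Longrightarrow> p = q"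
  obtains p where "p \<in> S" "w \<longlonglongrightarrow> p"
proof -
  have "\<exists>l\<in>S. \<exists>r. strict_mono r \<and> (v \<circ> r) \<longlonglongrightarrow> l" if "\<And>m. v m \<in> S" for v :: "nat \<Rightarrow> 'a"
    using \<open>compact S\<close> that unfolding compact_def by blast
  note sub = this
  obtain p r where p: "p \<in> S" "strict_mono r" "(w \<circ> r) \<longlonglongrightarrow> p"
    using sub[of w] assms(2) by blast
  have "w \<longlonglongrightarrow> p"
  proof (rule ccontr)
    assume "\<not> w \<longlonglongrightarrow> p"
    then obtain e where e: "e > 0" "\<not> (\<forall>\<^sub>F m in sequentially. dist (w m) p < e)"
      unfolding tendsto_iff by blast
    define B where "B = {m. e \<le> dist (w m) p}"
    have "infinite B"
      using e(2) by (auto simp: B_def eventually_sequentially infinite_nat_iff_unbounded_le not_less)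
    then have B: "strict_mono (enumerate B)" "\<And>m. enumerate B m \<in> B"
      by (auto simp: strict_mono_enumerate enumerate_in_set)
    obtain q s where q: "q \<in> S" "strict_mono s" "((w \<circ> enumerate B) \<circ> s) \<longlonglongrightarrow> q"
      using sub[of "w \<circ> enumerate B"] assms(2) by auto
    have "q = p"
      using uniq[of "enumerate B \<circ> s" r q p] p q B(1) by (simp add: strict_mono_o comp_assoc)
    then have "\<forall>\<^sub>F m in sequentially. dist ((w \<circ> enumerate B \<circ> s) m) p < e"
      using q(3) e(1) by (auto simp: tendsto_iff)
    then obtain m where "dist (w (enumerate B (s m))) p < e"
      by (auto simp: eventually_sequentially)
    then show False
      using B(2)[of "s m"] by (simp add: B_def)
  qed
  with p(1) show thesis
    by (rule that)
qed

text \<open>There are finitely many residue classes modulo \<open>u\<close>, so they have a common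
  threshold; then write k = k mod u + (k div u) * u.\<close>

lemma tendsto_if_residues_tendsto:
  fixes g :: "nat \<Rightarrow> 'a::metric_space"
  assumes "u > 0" "\<And>j. j < u \<Longrightarrow> (\<lambda>m. g (j + m * u)) \<longlonglongrightarrow> l"
  shows "g \<longlonglongrightarrow> l"
proof (rule tendstoI)
  fix e :: real assume "e > 0"
  then have "\<forall>j\<in>{..<u}. \<forall>\<^sub>F m in sequentially. dist (g (j + m * u)) l < e"
    using assms(2) by (auto simp: tendsto_iff)
  then have "\<forall>\<^sub>F m in sequentially. \<forall>j\<in>{..<u}. dist (g (j + m * u)) l < e"
    by (intro eventually_ball_finite) auto
  then obtain M where M: "\<And>m j. m \<ge> M \<Longrightarrow> j < u \<Longrightarrow> dist (g (j + m * u)) l < e"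
    by (auto simp: eventually_sequentially)
  have "dist (g k) l < e" if "k \<ge> M * u" for k
  proof -
    have "M \<le> k div u"
      using that \<open>u > 0\<close> by (simp add: less_eq_div_iff_mult_less_eq)
    then show ?thesis
      using M[of "k div u" "k mod u"] \<open>u > 0\<close> by simp
  qed
  then show "\<forall>\<^sub>F k in sequentially. dist (g k) l < e"
    by (auto simp: eventually_sequentially)
qed

section \<open>Convergence of the solutions of a periodic system\<close>

locale periodic_odts =
  fixes f :: "nat \<Rightarrow> real ^ 'n::{finite,linorder} \<Rightarrow> real ^ 'n::_"
    and \<Omega> :: "(real ^ 'n::_) set" and T h :: nat
  assumes C1: "\<And>k. C1_map (f k)"
    and compact: "compact \<Omega>"
    and evolve: "trajectories_evolve_on f \<Omega>"
    and T: "T \<ge> 1"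
    and periodic: "\<And>k a. a \<in> \<Omega> \<Longrightarrow> f k a = f (k + T) a"
    and h: "h \<ge> 1"
    and odts: "odts h \<Omega> (segment_jacobian f)"
begin

lemma periodic_mult: "a \<in> \<Omega> \<Longrightarrow> f (k + m * T) a = f k a"
proof (induction m)
  case (Suc m)
  then show ?case
    using periodic[of a "k + m * T"] by (simp add: add_ac)
qed simp

lemma is_solution_shift:
  assumes "is_solution f x" "\<And>k. x k \<in> \<Omega>"
  shows "is_solution f (\<lambda>k. x (k + m * (h * T)))"
  unfolding is_solution_def
proof
  fix k
  have "x (k + 1 + m * (h * T)) = f (k + m * h * T) (x (k + m * (h * T)))"
    using assms(1) by (simp add: is_solution_def mult.assoc)
  then show "x (k + 1 + m * (h * T)) = f k (x (k + m * (h * T)))"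
    using periodic_mult[OF assms(2)] by simp
qed

text \<open>Since \<open>h * T\<close> is a multiple of the period, sampling a solution at multiples
  of \<open>h * T\<close> iterates a single map, the period map
  \<open>\<lambda>a. flow f a (h * T)\<close>.\<close>

lemma flow_shift:
  assumes "is_solution f x" "\<And>k. x k \<in> \<Omega>"
  shows "flow f (x (m * (h * T))) k = x (k + m * (h * T))"
  using is_solution_eq_flow[OF is_solution_shift[OF assms, of m], of k] by simp

text \<open>The factors of \<open>left_prod\<close> are numbered from 1 while the first one acts at
  time \<open>k\<close>; this explains \<open>k + i - 1\<close>.\<close>

lemma difference_left_prod:
  assumes "is_solution f x" "is_solution f y"
  shows "y (k + j) - x (k + j) =
    left_prod (\<lambda>i. segment_jacobian f (k + i - 1) (y (k + i - 1)) (x (k + i - 1))) j *v (y k - x k)"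
proof (induction j)
  case (Suc j)
  have "y (k + Suc j) - x (k + Suc j) =
      segment_jacobian f (k + j) (y (k + j)) (x (k + j)) *v (y (k + j) - x (k + j))"
    using assms by (simp add: segment_jacobian_mult[OF C1] is_solution_def)
  then show ?case
    by (simp add: Suc matrix_vector_mul_assoc)
qed simp

text \<open>Time is cut into blocks of \<open>h\<close> consecutive steps. Over one block the
  difference is multiplied by a product of \<open>h\<close> matrices at increasing times, which is
  totally positive by the order of the system.\<close>

lemma difference_eventually_constant_sign:
  assumes x: "is_solution f x" "\<And>k. x k \<in> \<Omega>" and y: "is_solution f y" "\<And>k. y k \<in> \<Omega>"
    and "x 0 \<noteq> y 0"
  shows "\<exists>e K. (e = 1 \<or> e = (-1::real)) \<and> (\<forall>m\<ge>K. 0 < e * (y (m * h) - x (m * h)) $ Min UNIV)"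
proof -
  define A where "A m = left_prod (\<lambda>i. segment_jacobian f (m * h + i - 1)
    (y (m * h + i - 1)) (x (m * h + i - 1))) h" for m
  have tp: "totally_positive (A m)" for m
  proof -
    have "strict_mono_on {1..h} (\<lambda>i. m * h + i - 1)"
      by (auto simp: strict_mono_on_def)
    moreover have "(\<lambda>i. y (m * h + i - 1)) ` {1..h} \<subseteq> \<Omega>" "(\<lambda>i. x (m * h + i - 1)) ` {1..h} \<subseteq> \<Omega>"
      using x(2) y(2) by auto
    ultimately show ?thesis
      unfolding A_def
      by (rule conjunct2[OF odts[unfolded odts_def], rule_format,
          of "\<lambda>i. m * h + i - 1" "\<lambda>i. y (m * h + i - 1)" "\<lambda>i. x (m * h + i - 1)"])
  qed
  have step: "y (Suc m * h) - x (Suc m * h) = A m *v (y (m * h) - x (m * h))" for m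
    using difference_left_prod[OF x(1) y(1), of "m * h" h] by (simp add: A_def add.commute)
  have "y (0 * h) - x (0 * h) \<noteq> 0"
    using \<open>x 0 \<noteq> y 0\<close> by simp
  then show ?thesis
    by (rule eventually_constant_sign[of A "\<lambda>m. y (m * h) - x (m * h)", OF tp step])
qed

text \<open>The solution is compared with its own shift by \<open>h * T\<close>. If both start at
  the same point, the samples are constant; otherwise their first components are eventually
  monotone, and they are bounded.\<close>

lemma convergent_first_component:
  assumes x: "is_solution f x" "\<And>k. x k \<in> \<Omega>"
  shows "convergent (\<lambda>m. x (m * (h * T)) $ Min UNIV)"
proof (cases "x 0 = x (h * T)")
  case True
  have "x (m * (h * T)) = x 0" for m
  proof (induction m)
    case (Suc m)
    have "x (h * T + m * (h * T)) = flow f (x 0) (h * T)"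
      using flow_shift[OF x, of m "h * T"] unfolding Suc by (rule sym)
    also have "\<dots> = x 0"
      unfolding is_solution_eq_flow[OF x(1), symmetric] by (rule True[symmetric])
    finally show ?case
      by simp
  qed simp
  then show ?thesis
    by (simp add: convergent_const)
next
  case False
  define s where "s m = x (m * (h * T)) $ Min UNIV" for m
  obtain e K where e: "e = 1 \<or> e = (-1::real)"
    and K: "\<And>m. m \<ge> K \<Longrightarrow> 0 < e * (x (m * h + h * T) - x (m * h)) $ Min UNIV"
    using difference_eventually_constant_sign[OF x is_solution_shift[OF x, of 1] x(2)] False
    unfolding add_0 mult_1 by blast
  \<comment> \<open>The sign is known at multiples of \<open>h\<close>. It is used at the index
    \<open>m * T\<close>, which is at least \<open>K\<close> and belongs to the sampling time
    \<open>m * (h * T)\<close>.\<close>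
  have "e * s m \<le> e * s (Suc m)" if "m \<ge> K" for m
  proof -
    have "m \<le> m * T"
      using T by simp
    with that have "0 < e * (x (m * T * h + h * T) - x (m * T * h)) $ Min UNIV"
      by (intro K) linarith
    then show ?thesis
      by (simp add: s_def algebra_simps)
  qed
  then have "incseq (\<lambda>m. e * s (m + K))"
    by (intro incseq_SucI) simp
  moreover have "Bseq (\<lambda>m. e * s (m + K))"
  proof -
    obtain B where B: "\<And>a. a \<in> \<Omega> \<Longrightarrow> norm a \<le> B"
      using compact_imp_bounded[OF compact] by (auto simp: bounded_iff)
    have "norm (e * s (m + K)) \<le> B" for m
    proof -
      have "norm (e * s (m + K)) = norm (x ((m + K) * (h * T)) $ Min UNIV)"
        using e by (auto simp: s_def)
      also have "\<dots> \<le> norm (x ((m + K) * (h * T)))"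
        by (rule Finite_Cartesian_Product.norm_nth_le)
      also have "\<dots> \<le> B"
        by (rule B[OF x(2)])
      finally show ?thesis .
    qed
    then show ?thesis
      by (rule BseqI')
  qed
  ultimately have "convergent (\<lambda>m. e * s (m + K))"
    by (intro Bseq_monoseq_convergent incseq_imp_monoseq)
  then have "convergent (\<lambda>m. e * (e * s (m + K)))"
    by (rule convergent_mult[OF convergent_const])
  also have "(\<lambda>m. e * (e * s (m + K))) = (\<lambda>m. s (m + K))"
    using e by auto
  finally have "convergent (\<lambda>m. s (m + K))" .
  then have "convergent s"
    by (simp only: convergent_ignore_initial_segment)
  then show ?thesis
    by (simp only: s_def[abs_def])
qed

text \<open>By continuity of the flow, \<open>j\<close> periods after \<open>p\<close> one reaches
  the limit of the samples with index \<open>j + r i\<close>, and their first components tend to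
  \<open>L\<close> as well.\<close>

lemma first_component_limit_orbit:
  assumes x: "is_solution f x" "\<And>k. x k \<in> \<Omega>"
    and L: "(\<lambda>m. x (m * (h * T)) $ Min UNIV) \<longlonglongrightarrow> L"
    and r: "strict_mono r" "((\<lambda>m. x (m * (h * T))) \<circ> r) \<longlonglongrightarrow> p"
  shows "flow f p (j * (h * T)) $ Min UNIV = L"
proof -
  have "isCont (\<lambda>a. flow f a (j * (h * T))) p"
    using continuous_on_flow[OF C1] by (simp add: continuous_on_eq_continuous_at)
  moreover have "(\<lambda>i. x (r i * (h * T))) \<longlonglongrightarrow> p"
    using r(2) by (simp add: comp_def)
  ultimately have "(\<lambda>i. flow f (x (r i * (h * T))) (j * (h * T))) \<longlonglongrightarrow> flow f p (j * (h * T))"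
    by (rule isCont_tendsto_compose)
  then have "(\<lambda>i. x ((j + r i) * (h * T)) $ Min UNIV) \<longlonglongrightarrow> flow f p (j * (h * T)) $ Min UNIV"
    by (intro tendsto_vec_nth) (simp add: flow_shift[OF x] add_mult_distrib)
  moreover have "filterlim (\<lambda>i. j + r i) sequentially sequentially"
    by (rule filterlim_at_top_mono[OF filterlim_subseq[OF r(1)]]) simp
  then have "(\<lambda>i. x ((j + r i) * (h * T)) $ Min UNIV) \<longlonglongrightarrow> L"
    by (rule filterlim_compose[OF L])
  ultimately show ?thesis
    by (rule LIMSEQ_unique)
qed

text \<open>The samples converge to some \<open>p\<close>, which the period map fixes. The orbit of
  \<open>p\<close> is the periodic solution, and the flow's continuity carries the convergence to
  every residue class modulo \<open>h * T\<close>.\<close>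

lemma solution_converges:
  assumes x: "is_solution f x" "x 0 \<in> \<Omega>"
  shows "converges_to_periodic_solution f (h * T) x"
proof -
  have in_\<Omega>: "x k \<in> \<Omega>" for k
    using is_solution_eq_flow[OF x(1)] flow_in[OF evolve x(2)] by metis
  note x = x(1) in_\<Omega>
  define w where "w m = x (m * (h * T))" for m
  obtain L where L: "(\<lambda>m. w m $ Min UNIV) \<longlonglongrightarrow> L"
    using convergent_first_component[OF x] by (auto simp: convergent_def w_def)
  obtain p where p: "p \<in> \<Omega>" "w \<longlonglongrightarrow> p"
  proof (rule tendsto_if_limit_point_unique[OF compact])
    show "w m \<in> \<Omega>" for m
      by (simp add: w_def in_\<Omega>)
  next
    fix r s p q
    assume lim: "strict_mono r" "strict_mono s" "p \<in> \<Omega>" "q \<in> \<Omega>"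
      "(w \<circ> r) \<longlonglongrightarrow> p" "(w \<circ> s) \<longlonglongrightarrow> q"
    show "p = q"
    proof (rule ccontr)
      assume "p \<noteq> q"
      then obtain e K where "e = 1 \<or> e = (-1::real)"
        and K: "\<And>m. m \<ge> K \<Longrightarrow> 0 < e * (flow f q (m * h) - flow f p (m * h)) $ Min UNIV"
        using difference_eventually_constant_sign[OF is_solution_flow flow_in[OF evolve lim(3)]
            is_solution_flow flow_in[OF evolve lim(4)]] unfolding flow.simps by blast
      \<comment> \<open>The time \<open>K * T * h\<close> is both late enough for the sign property
        and a whole number of periods, where both orbits have first component
        \<open>L\<close>.\<close>
      have "K \<le> K * T"
        using T by simp
      then have "0 < e * (flow f q (K * T * h) - flow f p (K * T * h)) $ Min UNIV"
        by (rule K)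
      moreover have "flow f p (K * T * h) $ Min UNIV = L"
        using first_component_limit_orbit[OF x L[unfolded w_def] lim(1) lim(5)[unfolded w_def], of K]
        by (simp only: ac_simps)
      moreover have "flow f q (K * T * h) $ Min UNIV = L"
        using first_component_limit_orbit[OF x L[unfolded w_def] lim(2) lim(6)[unfolded w_def], of K]
        by (simp only: ac_simps)
      ultimately show False
        by simp
    qed
  qed
  have flow_lim: "(\<lambda>m. x (j + m * (h * T))) \<longlonglongrightarrow> flow f p j" for j
  proof -
    have "isCont (\<lambda>a. flow f a j) p"
      using continuous_on_flow[OF C1] by (simp add: continuous_on_eq_continuous_at)
    then have "(\<lambda>m. flow f (w m) j) \<longlonglongrightarrow> flow f p j"
      using p(2) by (rule isCont_tendsto_compose)
    then show ?thesis
      by (simp add: w_def flow_shift[OF x])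
  qed
  \<comment> \<open>The shifted samples tend to the image of \<open>p\<close> under the period map
    and, as a tail of \<open>w\<close>, to \<open>p\<close>.\<close>
  have "(\<lambda>m. w (Suc m)) \<longlonglongrightarrow> flow f p (h * T)"
    using flow_lim[of "h * T"] by (simp add: w_def)
  moreover have "(\<lambda>m. w (Suc m)) \<longlonglongrightarrow> p"
    using p(2) by (rule LIMSEQ_Suc)
  ultimately have fix_p: "flow f p (h * T) = p"
    by (rule LIMSEQ_unique)
  have per: "flow f p (j + m * (h * T)) = flow f p j" for j m
  proof (induction m)
    case (Suc m)
    have "flow f p (j + m * (h * T) + 1 * (h * T)) = flow f (flow f p (1 * (h * T))) (j + m * (h * T))"
      by (rule flow_shift[symmetric]) (use is_solution_flow flow_in[OF evolve p(1)] in auto)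
    also have "\<dots> = flow f p j"
      by (simp only: mult_1 fix_p Suc)
    finally show ?case
      by (simp only: mult_Suc mult_1 add_ac)
  qed simp
  have "(\<lambda>k. x k - flow f p k) \<longlonglongrightarrow> 0"
  proof (rule tendsto_if_residues_tendsto)
    show "0 < h * T"
      using T h by simp
    show "(\<lambda>m. x (j + m * (h * T)) - flow f p (j + m * (h * T))) \<longlonglongrightarrow> 0" for j
      using flow_lim[of j] by (simp add: per LIM_zero)
  qed
  moreover have "periodic_seq (h * T) (flow f p)"
    using per[of _ 1] by (simp add: periodic_seq_def)
  ultimately show ?thesis
    unfolding converges_to_periodic_solution_def
    by (intro exI[of _ "flow f p"] conjI is_solution_flow)
qed

end

theorem theorem2:
  fixes f :: "nat \<Rightarrow> real ^ 'n::{finite,linorder} \<Rightarrow> real ^ 'n::_"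
    and \<Omega> :: "(real ^ 'n::_) set"
    and T h u :: nat
  assumes "\<And>k. C1_map (f k)"
    and "compact \<Omega>" and "convex \<Omega>"
    and "trajectories_evolve_on f \<Omega>"
    and "T \<ge> 1"
    and "\<And>k a. a \<in> \<Omega> \<Longrightarrow> f k a = f (k + T) a"
    and "h \<ge> 1"
    and "odts h \<Omega> (segment_jacobian f)"
    and "u = h * T"
  shows "\<forall>x. is_solution f x \<longrightarrow> x 0 \<in> \<Omega> \<longrightarrow> converges_to_periodic_solution f u x"
proof -
  interpret periodic_odts f \<Omega> T h
    by unfold_locales (fact assms)+
  show ?thesis
    using solution_converges \<open>u = h * T\<close> by blast
qed

end
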